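(* Let $G$ be a (not necessarily connected) graph of order $n\ge 2$ and let $\overline G$ be its complement. Then $3\le\eta(G)+\eta(\overline G)\le 2n-1$. Moreover: (i) $\eta(G)+\eta(\overline G)=3$ if and only if $\{G,\overline G\}=\{K_2,\overline K_2\}$; (ii) $\eta(G)+\eta(\overline G)=2n-1$ if and only if $\{G,\overline G\}=\{K_n,\overline K_n\}$. (Equalities of graphs are up to isomorphism.)
   Context: Graphs are finite, simple and undirected, and not necessarily connected; a graph is nontrivial if it has order $n\ge 2$. $K_n$ is the complete graph and $\overline K_n$ the edgeless graph on $n$ vertices. For a graph $G=(V,E)$, $d(u,v)$ is the usual distance, with value $\infty$ when $u,v$ are in different components. A set $D=\{x_1,\dots,x_k\}\subseteq V$ is dominating if every vertex of $V\setminus D$ has a neighbor in $D$; it is locating if the vectors $(d(v,x_1),\dots,d(v,x_k))$, $v\in V$, are pairwise distinct. A metric-locating-dominating set is a set that is both dominating and locating. The metric-location-domination number $\eta(G)$ is the minimum cardinality of a metric-locating-dominating set of $G$. *)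

theory Defs
  imports "Graph_Theory.Graph_Theory"
begin

text \<open>
  A finite simple undirected graph is a term \<open>G\<close> with \<open>pair_graph G\<close>: a finite, symmetric,
  loop-free digraph without parallel arcs, in which the undirected edge \<open>uv\<close> is
  represented by the two arcs \<open>(u, v)\<close> and \<open>(v, u)\<close>. Connectedness is not required.
\<close>

text \<open>
  With unit arc weights, the library's shortest-path cost is the usual distance: the minimum
  number of arcs of a walk, and \<open>\<infinity>\<close> if there is no walk.
\<close>
definition graph_dist :: "'a pair_pre_digraph \<Rightarrow> 'a \<Rightarrow> 'a \<Rightarrow> ereal" where
  "graph_dist G u v = wf_digraph.\<mu> (with_proj G) (\<lambda>_. 1) u v"

definition dominating_set :: "'a pair_pre_digraph \<Rightarrow> 'a set \<Rightarrow> bool" where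
  "dominating_set G D \<longleftrightarrow>
     D \<subseteq> pverts G \<and> (\<forall>v \<in> pverts G - D. \<exists>x \<in> D. (v, x) \<in> parcs G)"

text \<open>
  The vector of distances from \<open>v\<close> to the members of \<open>D\<close> is indexed by \<open>D\<close> itself rather than
  by an enumeration of \<open>D\<close>.
\<close>
definition locating_set :: "'a pair_pre_digraph \<Rightarrow> 'a set \<Rightarrow> bool" where
  "locating_set G D \<longleftrightarrow>
     D \<subseteq> pverts G \<and> inj_on (\<lambda>v. restrict (graph_dist G v) D) (pverts G)"

definition metric_locating_dominating_set :: "'a pair_pre_digraph \<Rightarrow> 'a set \<Rightarrow> bool" where
  "metric_locating_dominating_set G D \<longleftrightarrow> dominating_set G D \<and> locating_set G D"

definition metric_location_domination_number :: "'a pair_pre_digraph \<Rightarrow> nat" (\<open>\<eta>\<close>) where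
  "\<eta> G = (LEAST k. \<exists>D. metric_locating_dominating_set G D \<and> card D = k)"

definition graph_complement :: "'a pair_pre_digraph \<Rightarrow> 'a pair_pre_digraph" where
  "graph_complement G =
     \<lparr> pverts = pverts G,
       parcs = {(u, v). u \<in> pverts G \<and> v \<in> pverts G \<and> u \<noteq> v \<and> (u, v) \<notin> parcs G} \<rparr>"

definition complete_graph :: "nat \<Rightarrow> nat pair_pre_digraph" where
  "complete_graph n =
     \<lparr> pverts = {0..<n}, parcs = {(i, j). i < n \<and> j < n \<and> i \<noteq> j} \<rparr>"

definition edgeless_graph :: "nat \<Rightarrow> nat pair_pre_digraph" where
  "edgeless_graph n = \<lparr> pverts = {0..<n}, parcs = {} \<rparr>"

definition graph_iso :: "'a pair_pre_digraph \<Rightarrow> 'b pair_pre_digraph \<Rightarrow> bool" (infix \<open>\<simeq>\<^sub>G\<close> 50) where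
  "G \<simeq>\<^sub>G H \<longleftrightarrow> digraph_iso (with_proj G) (with_proj H)"

lemma pair_graph_graph_complement:
  assumes "pair_graph G"
  shows "pair_graph (graph_complement G)"
proof -
  interpret pair_graph G by fact
  have sub: "parcs (graph_complement G) \<subseteq> pverts G \<times> pverts G"
    by (auto simp: graph_complement_def)
  have "finite (parcs (graph_complement G))"
    by (rule finite_subset[OF sub]) (simp add: pair_finite_verts)
  moreover have "sym (parcs G)"
    using pair_sym_arcs by (simp add: symmetric_def)
  ultimately show ?thesis
    by unfold_locales
      (auto simp: graph_complement_def symmetric_def pair_finite_verts intro!: symI dest: symD)
qed

lemma complete_digraph_complete_graph: "complete_digraph n (with_proj (complete_graph n))"
  by (auto simp: complete_digraph_pair_def complete_graph_def)

lemma edgeless_graph_eq_complement: "edgeless_graph n = graph_complement (complete_graph n)"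
  by (auto simp: edgeless_graph_def graph_complement_def complete_graph_def)

end

theory Submission
  imports Defs
begin

text \<open>
  A single vertex \<open>x\<close> can locate and dominate at most one vertex besides itself, since all the
  others are at distance 1 from it; and \<open>V - {u}\<close> is metric-locating-dominating as soon as \<open>u\<close> has
  a neighbor. So if neither \<open>G\<close> nor its complement is edgeless, then the sum is at most
  \<open>2 * n - 2\<close>, and otherwise it is \<open>n + \<eta> K\<^sub>n = 2 * n - 1\<close>. A sum of at most 3 forces one of the
  two numbers to be 1, hence \<open>n = 2\<close>, where one of the two graphs is edgeless.
\<close>

section \<open>Distances and locating sets\<close>

lemma (in pair_wf_digraph) graph_dist_self:
  assumes "v \<in> pverts G"
  shows "graph_dist G v v = 0"
  unfolding graph_dist_def \<mu>_def
proof (rule INF_eqI)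
  fix p assume "p \<in> {p. awalk v p v}"
  then show "0 \<le> ereal (awalk_cost (\<lambda>_. 1) p)"
    using pos_cost_pos_awalk_cost[of v p v "\<lambda>_. 1"] by simp
next
  fix y :: ereal
  assume "\<And>p. p \<in> {p. awalk v p v} \<Longrightarrow> y \<le> ereal (awalk_cost (\<lambda>_. 1) p)"
  \<comment> \<open>The empty walk attains the infimum; it is a walk because \<open>v\<close> is a
    vertex.\<close>
  from this[of "[]"] show "y \<le> 0"
    using assms by (simp add: awalk_Nil_iff zero_ereal_def)
qed

text \<open>A walk between distinct vertices has a first arc, which already costs 1. Without any
  walk the infimum is over the empty set, so the distance is infinite.\<close>

lemma (in pair_wf_digraph) graph_dist_ge_1:
  assumes "u \<noteq> v"
  shows "1 \<le> graph_dist G u v"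
  unfolding graph_dist_def \<mu>_def
proof (rule INF_greatest)
  fix p assume "p \<in> {p. awalk u p v}"
  then obtain e q where p: "p = e # q" and q: "awalk (snd e) q v"
    using assms by (cases p) (auto simp: awalk_simps)
  have "0 \<le> awalk_cost (\<lambda>_. 1) q"
    using pos_cost_pos_awalk_cost[OF q, of "\<lambda>_. 1"] by simp
  then show "1 \<le> ereal (awalk_cost (\<lambda>_. 1) p)"
    by (simp add: p one_ereal_def)
qed

lemma (in pair_loopfree_digraph) graph_dist_arc:
  assumes "(u, v) \<in> parcs G"
  shows "graph_dist G u v = 1"
proof (rule antisym)
  have "awalk u [(u, v)] v"
    using assms by (auto simp: awalk_simps dest: wellformed')
  from min_cost_le_walk_cost[OF this, of "\<lambda>_. 1"] show "graph_dist G u v \<le> 1"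
    by (simp add: graph_dist_def one_ereal_def)
  show "1 \<le> graph_dist G u v"
    using pair_no_loops[OF assms] by (intro graph_dist_ge_1) simp
qed

text \<open>A vertex in \<open>D\<close> has entry 0 at its own coordinate, where every other vertex
  has at least 1. So only two vertices outside \<open>D\<close> could share a vector, and at most
  one vertex lies there.\<close>

lemma (in pair_wf_digraph) locating_setI:
  assumes "D \<subseteq> pverts G"
    and "\<And>u v. u \<in> pverts G - D \<Longrightarrow> v \<in> pverts G - D \<Longrightarrow> u = v"
  shows "locating_set G D"
  unfolding locating_set_def
proof (intro conjI inj_onI)
  fix u v
  assume uv: "u \<in> pverts G" "v \<in> pverts G"
    and eq: "restrict (graph_dist G u) D = restrict (graph_dist G v) D"
  have *: "graph_dist G u x = graph_dist G v x" if "x \<in> D" for x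
    using fun_cong[OF eq, of x] that by simp
  show "u = v"
  proof (rule ccontr)
    assume "u \<noteq> v"
    then have "u \<in> D \<or> v \<in> D"
      using assms(2) uv by blast
    then show False
      using * graph_dist_self[OF uv(1)] graph_dist_self[OF uv(2)]
        graph_dist_ge_1[of u v] graph_dist_ge_1[of v u] \<open>u \<noteq> v\<close>
      by auto
  qed
qed (fact assms(1))

text \<open>Both distance vectors are constantly 1. The case \<open>D = {x}\<close> limits the order
  when the number is 1; general \<open>D\<close> serves for complete graphs.\<close>

lemma (in pair_loopfree_digraph) locating_set_outside_neighbors:
  assumes "locating_set G D" "u \<in> pverts G" "v \<in> pverts G"
    and "\<And>x. x \<in> D \<Longrightarrow> (u, x) \<in> parcs G \<and> (v, x) \<in> parcs G"
  shows "u = v"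
proof (rule inj_onD)
  show "inj_on (\<lambda>v. restrict (graph_dist G v) D) (pverts G)"
    using assms(1) by (simp add: locating_set_def)
  show "restrict (graph_dist G u) D = restrict (graph_dist G v) D"
    using assms(4) by (intro restrict_ext) (simp add: graph_dist_arc)
qed (use assms in auto)

section \<open>Values and bounds of the metric-location-domination number\<close>

lemma (in pair_wf_digraph) metric_locating_dominating_set_pverts:
  "metric_locating_dominating_set G (pverts G)"
  by (auto simp: metric_locating_dominating_set_def dominating_set_def intro: locating_setI)

lemma metric_location_domination_number_le:
  "metric_locating_dominating_set G D \<Longrightarrow> \<eta> G \<le> card D"
  unfolding metric_location_domination_number_def by (rule Least_le) blast

text \<open>The whole vertex set qualifies, so the \<open>LEAST\<close> ranges over a nonempty set
  of sizes and is attained.\<close>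

lemma (in pair_wf_digraph) metric_location_domination_number_witness:
  obtains D where "metric_locating_dominating_set G D" "card D = \<eta> G"
  using LeastI_ex[of "\<lambda>k. \<exists>D. metric_locating_dominating_set G D \<and> card D = k"]
    metric_locating_dominating_set_pverts
  unfolding metric_location_domination_number_def by blast

text \<open>The empty set dominates no vertex.\<close>

lemma (in pair_graph) metric_location_domination_number_pos:
  assumes "pverts G \<noteq> {}"
  shows "0 < \<eta> G"
proof -
  obtain D where D: "metric_locating_dominating_set G D" "card D = \<eta> G"
    by (rule metric_location_domination_number_witness)
  then have "D \<subseteq> pverts G" "D \<noteq> {}"
    using assms by (auto simp: metric_locating_dominating_set_def dominating_set_def)
  then show ?thesis
    \<comment> \<open>\<open>card\<close> is also 0 on infinite sets, so
      \<open>D \<noteq> {}\<close> alone would not give a positive cardinality.\<close>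
    using D(2) finite_subset[OF _ pair_finite_verts] by (metis card_gt_0_iff)
qed

lemma (in pair_graph) card_le_2_if_metric_location_domination_number_1:
  assumes "\<eta> G = 1"
  shows "card (pverts G) \<le> 2"
proof -
  obtain x where x: "metric_locating_dominating_set G {x}"
    using metric_location_domination_number_witness assms by (metis card_1_singletonE)
  then have eq: "u = v" if "u \<in> pverts G - {x}" "v \<in> pverts G - {x}" for u v
    using that
    by (intro locating_set_outside_neighbors[of "{x}"])
      (auto simp: metric_locating_dominating_set_def dominating_set_def)
  have "card (pverts G - {x}) \<le> 1"
    using pair_finite_verts eq by (auto simp: card_le_Suc0_iff_eq)
  then show ?thesis
    using x pair_finite_verts
    by (simp add: metric_locating_dominating_set_def dominating_set_def)
qed

lemma (in pair_graph) metric_location_domination_number_less_card: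
  assumes "parcs G \<noteq> {}"
  shows "\<eta> G < card (pverts G)"
proof -
  obtain u v where uv: "(u, v) \<in> parcs G"
    using assms by auto
  then have u: "u \<in> pverts G" and v: "v \<in> pverts G - {u}"
    using pair_no_loops[OF uv] by (auto dest: wellformed')
  have "metric_locating_dominating_set G (pverts G - {u})"
    unfolding metric_locating_dominating_set_def dominating_set_def
    using uv v by (auto intro!: locating_setI)
  from metric_location_domination_number_le[OF this] show ?thesis
    using u pair_finite_verts by (metis card_Diff1_less le_less_trans)
qed

text \<open>Without arcs a vertex outside \<open>D\<close> has no neighbor in \<open>D\<close>, so
  domination forces \<open>D\<close> to be everything.\<close>

lemma (in pair_graph) metric_location_domination_number_edgeless:
  assumes "parcs G = {}"
  shows "\<eta> G = card (pverts G)"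
proof -
  obtain D where D: "metric_locating_dominating_set G D" "card D = \<eta> G"
    by (rule metric_location_domination_number_witness)
  then have "D = pverts G"
    using assms by (auto simp: metric_locating_dominating_set_def dominating_set_def)
  with D show ?thesis by simp
qed

lemma parcs_if_complement_edgeless:
  assumes "pair_graph G" "parcs (graph_complement G) = {}"
  shows "parcs G = {(u, v). u \<in> pverts G \<and> v \<in> pverts G \<and> u \<noteq> v}"
proof -
  interpret pair_graph G by fact
  show ?thesis
    using assms(2) by (auto simp: graph_complement_def dest: wellformed' pair_no_loops)
qed

text \<open>Vertices outside \<open>D\<close> are adjacent to all of \<open>D\<close>, so at most
  one is left out; the matching upper bound holds since \<open>G\<close> has an arc. Completeness is
  stated as edgelessness of the complement, so that the lemma applies to either graph of the
  pair.\<close>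

lemma metric_location_domination_number_complete:
  assumes "pair_graph G" "parcs (graph_complement G) = {}" "2 \<le> card (pverts G)"
  shows "\<eta> G = card (pverts G) - 1"
proof -
  interpret pair_graph G by fact
  note arcs = parcs_if_complement_edgeless[OF assms(1,2)]
  obtain D where D: "metric_locating_dominating_set G D" "card D = \<eta> G"
    by (rule metric_location_domination_number_witness)
  then have sub: "D \<subseteq> pverts G" and loc: "locating_set G D"
    by (auto simp: metric_locating_dominating_set_def dominating_set_def)
  have "u = v" if "u \<in> pverts G - D" "v \<in> pverts G - D" for u v
    using that sub by (intro locating_set_outside_neighbors[OF loc]) (auto simp: arcs)
  then have "card (pverts G - D) \<le> 1"
    using pair_finite_verts by (auto simp: card_le_Suc0_iff_eq)
  then have lower: "card (pverts G) \<le> \<eta> G + 1"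
    using D(2) sub pair_finite_verts by (simp add: card_Diff_subset finite_subset)
  \<comment> \<open>Order at least 2 supplies the arc. On a single vertex the number is 1, not
    \<open>card (pverts G) - 1\<close>.\<close>
  obtain u v where "u \<in> pverts G" "v \<in> pverts G" "u \<noteq> v"
    using assms(3) by (auto simp: numeral_2_eq_2 card_le_Suc_iff)
  then have "parcs G \<noteq> {}"
    by (auto simp: arcs)
  from metric_location_domination_number_less_card[OF this] lower show ?thesis
    by simp
qed

section \<open>Complements and isomorphism with edgeless or complete graphs\<close>

lemma pverts_graph_complement [simp]: "pverts (graph_complement G) = pverts G"
  by (simp add: graph_complement_def)

lemma graph_complement_involution:
  assumes "pair_graph G"
  shows "graph_complement (graph_complement G) = G"
proof -
  interpret pair_graph G by fact
  have "parcs (graph_complement (graph_complement G)) = parcs G"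
    by (auto simp: graph_complement_def dest: wellformed' pair_no_loops)
  then show ?thesis
    by simp
qed

text \<open>Arcs are pairs of vertices, so a vertex bijection \<open>f\<close> induces the arc map
  \<open>map_prod f f\<close>, and these two fill the isomorphism record.\<close>

lemma graph_isoI:
  assumes "pair_wf_digraph G" "bij_betw f (pverts G) (pverts H)"
    and "parcs H = map_prod f f ` parcs G"
  shows "G \<simeq>\<^sub>G H"
proof -
  interpret pair_wf_digraph G by fact
  let ?h = "\<lparr>iso_verts = f, iso_arcs = map_prod f f, iso_head = snd, iso_tail = fst\<rparr>"
  have f: "inj_on f (pverts G)" "f ` pverts G = pverts H"
    using assms(2) by (auto simp: bij_betw_def)
  have "inj_on (map_prod f f) (parcs G)"
    using map_prod_inj_on[OF f(1) f(1)] by (rule inj_on_subset) (auto dest: wellformed')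
  then have "digraph_isomorphism ?h"
    using f(1) wf_digraph_axioms by (simp add: digraph_isomorphism_def)
  moreover have "with_proj H = app_iso ?h (with_proj G)"
    using f(2) assms(3) by (simp add: app_iso_def with_proj_def)
  ultimately show ?thesis
    unfolding graph_iso_def digraph_iso_def by blast
qed

text \<open>Each alternative in the equality cases contains an edgeless graph, so reading off
  structure from an isomorphism is needed only here; for complete graphs an introduction rule
  suffices.\<close>

lemma graph_iso_edgeless_graph_iff:
  assumes "pair_graph G"
  shows "G \<simeq>\<^sub>G edgeless_graph n \<longleftrightarrow> parcs G = {} \<and> card (pverts G) = n"
proof -
  interpret pair_graph G by fact
  show ?thesis
  proof
    assume "G \<simeq>\<^sub>G edgeless_graph n"
    then obtain h where h: "digraph_isomorphism h"
      and H: "with_proj (edgeless_graph n) = app_iso h (with_proj G)"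
      unfolding graph_iso_def digraph_iso_def by blast
    have "iso_arcs h ` parcs G = {}" and "iso_verts h ` pverts G = {0..<n}"
      using arg_cong[OF H, of arcs] arg_cong[OF H, of verts]
      by (simp_all add: edgeless_graph_def)
    moreover have "card (iso_verts h ` pverts G) = card (pverts G)"
      using h by (intro card_image) (simp add: digraph_isomorphism_def)
    ultimately show "parcs G = {} \<and> card (pverts G) = n"
      by simp
  next
    assume *: "parcs G = {} \<and> card (pverts G) = n"
    then obtain f where "bij_betw f (pverts G) {0..<n}"
      using ex_bij_betw_finite_nat[OF pair_finite_verts] by auto
    then show "G \<simeq>\<^sub>G edgeless_graph n"
      using * by (intro graph_isoI pair_wf_digraph_axioms) (auto simp: edgeless_graph_def)
  qed
qed

lemma graph_iso_complete_graphI: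
  assumes "pair_graph G" "parcs (graph_complement G) = {}" "card (pverts G) = n"
  shows "G \<simeq>\<^sub>G complete_graph n"
proof -
  interpret pair_graph G by fact
  obtain f where f: "bij_betw f (pverts G) {0..<n}"
    using ex_bij_betw_finite_nat[OF pair_finite_verts] assms(3) by auto
  then have inj: "inj_on f (pverts G)" and img: "{0..<n} = f ` pverts G"
    by (auto simp: bij_betw_def)
  have "parcs (complete_graph n) = {(i, j). i \<in> {0..<n} \<and> j \<in> {0..<n} \<and> i \<noteq> j}"
    by (auto simp: complete_graph_def)
  \<comment> \<open>With \<open>{0..<n}\<close> written as an image, \<open>i \<noteq> j\<close>
    becomes \<open>f u \<noteq> f v\<close>, which injectivity turns into
    \<open>u \<noteq> v\<close>.\<close>
  also have "\<dots> = map_prod f f ` parcs G"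
    unfolding img parcs_if_complement_edgeless[OF assms(1,2)]
    using inj by (auto simp: inj_on_eq_iff intro: map_prod_imageI)
  finally show ?thesis
    using f by (intro graph_isoI pair_wf_digraph_axioms) (auto simp: complete_graph_def)
qed

section \<open>Bounds for the sum over a graph and its complement, with the extremal pairs\<close>

theorem theorem3:
  fixes G :: "'a pair_pre_digraph" and n :: nat
  assumes "pair_graph G"
    and "card (pverts G) = n"
    and "n \<ge> 2"
  shows "3 \<le> \<eta> G + \<eta> (graph_complement G)
    \<and> \<eta> G + \<eta> (graph_complement G) \<le> 2 * n - 1
    \<and> (\<eta> G + \<eta> (graph_complement G) = 3 \<longleftrightarrow>
         (G \<simeq>\<^sub>G complete_graph 2 \<and> graph_complement G \<simeq>\<^sub>G edgeless_graph 2) \<or>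
         (G \<simeq>\<^sub>G edgeless_graph 2 \<and> graph_complement G \<simeq>\<^sub>G complete_graph 2))
    \<and> (\<eta> G + \<eta> (graph_complement G) = 2 * n - 1 \<longleftrightarrow>
         (G \<simeq>\<^sub>G complete_graph n \<and> graph_complement G \<simeq>\<^sub>G edgeless_graph n) \<or>
         (G \<simeq>\<^sub>G edgeless_graph n \<and> graph_complement G \<simeq>\<^sub>G complete_graph n))"
proof -
  let ?H = "graph_complement G"
  let ?s = "\<eta> G + \<eta> ?H"
  let ?iso = "\<lambda>n. (G \<simeq>\<^sub>G complete_graph n \<and> ?H \<simeq>\<^sub>G edgeless_graph n) \<or>
    (G \<simeq>\<^sub>G edgeless_graph n \<and> ?H \<simeq>\<^sub>G complete_graph n)"
  interpret G: pair_graph G by fact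
  have pH: "pair_graph ?H"
    by (rule pair_graph_graph_complement) fact
  interpret H: pair_graph ?H by fact
  note HH = graph_complement_involution[OF assms(1)]
  \<comment> \<open>The parameter \<open>m\<close> stays free because both \<open>m = n\<close> and
    \<open>m = 2\<close> are used. \<open>HH\<close> lets the complete-graph rule act on
    \<open>?H\<close>, whose complement is \<open>G\<close>.\<close>
  have iso_iff: "?iso m \<longleftrightarrow> (parcs G = {} \<or> parcs ?H = {}) \<and> m = n" for m
    using graph_iso_edgeless_graph_iff[OF assms(1), of m] graph_iso_edgeless_graph_iff[OF pH, of m]
      graph_iso_complete_graphI[OF assms(1), of m] graph_iso_complete_graphI[OF pH, of m]
      assms(2) HH by auto
  have edgeless: "?s = 2 * n - 1" if "parcs G = {} \<or> parcs ?H = {}"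
    using that G.metric_location_domination_number_edgeless
      H.metric_location_domination_number_edgeless
      metric_location_domination_number_complete[OF assms(1)]
      metric_location_domination_number_complete[OF pH] assms(2,3) HH
    by auto
  have other: "?s \<le> 2 * n - 2" if "\<not> (parcs G = {} \<or> parcs ?H = {})"
    using that G.metric_location_domination_number_less_card
      H.metric_location_domination_number_less_card assms(2) by auto
  \<comment> \<open>As \<open>n \<ge> 2\<close>, truncated subtraction still separates
    \<open>2 * n - 2\<close> from \<open>2 * n - 1\<close>, so equality holds exactly when one of
    the graphs is edgeless.\<close>
  have ii: "?s = 2 * n - 1 \<longleftrightarrow> ?iso n"
    using edgeless other iso_iff[of n] assms(3) by linarith
  have upper: "?s \<le> 2 * n - 1"
    using edgeless other by (cases "parcs G = {} \<or> parcs ?H = {}") auto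
  have "pverts G \<noteq> {}"
    using assms(2,3) by auto
  then have pos: "0 < \<eta> G" "0 < \<eta> ?H"
    using G.metric_location_domination_number_pos H.metric_location_domination_number_pos
    by simp_all
  have n2: "n = 2" if "?s \<le> 3"
  proof -
    \<comment> \<open>Two positive summands with sum at most 3 cannot both be at least 2.\<close>
    have "\<eta> G = 1 \<or> \<eta> ?H = 1"
      using that pos by linarith
    then show ?thesis
      using G.card_le_2_if_metric_location_domination_number_1
        H.card_le_2_if_metric_location_domination_number_1 assms(2,3) by auto
  qed
  \<comment> \<open>Two vertices admit a single edge. If \<open>G\<close> has it, then by symmetry
    \<open>G\<close> contains both arcs and none is left for \<open>?H\<close>.\<close>
  have "parcs G = {} \<or> parcs ?H = {}" if "n = 2"
  proof (rule ccontr)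
    assume "\<not> ?thesis"
    then obtain u v x y where uv: "(u, v) \<in> parcs G" and xy: "(x, y) \<in> parcs ?H"
      by auto
    obtain a b where ab: "pverts G = {a, b}"
      using assms(2) \<open>n = 2\<close> by (auto simp: card_2_iff)
    have "u \<in> {a, b}" "v \<in> {a, b}"
      using G.wellformed'[OF uv] ab by simp_all
    moreover have "(v, u) \<in> parcs G"
      using uv G.pair_sym_arcs by (simp add: symmetric_def symD)
    ultimately show False
      using uv xy ab G.pair_no_loops[OF uv] by (auto simp: graph_complement_def)
  qed
  then have eq: "?s = 3" if "n = 2"
    using edgeless that by simp
  \<comment> \<open>A sum of at most 3 forces \<open>n = 2\<close>, and there the sum is exactly
    3.\<close>
  then have "3 \<le> ?s"
    using n2 by (cases "?s \<le> 3") auto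
  moreover have "?s = 3 \<longleftrightarrow> ?iso 2"
  proof
    assume "?s = 3"
    \<comment> \<open>For \<open>n = 2\<close> the upper bound \<open>2 * n - 1\<close> is 3, so
      this is an instance of \<open>ii\<close>.\<close>
    then show "?iso 2"
      using n2 ii by simp
  next
    assume "?iso 2"
    then have "n = 2"
      using iso_iff[of 2] by simp
    then show "?s = 3"
      by (rule eq)
  qed
  ultimately show ?thesis
    using upper ii by (intro conjI)
qed

end
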